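(* Let $N\ge 1$, $\Sigma_N=\{1,\dots,N\}$, $\omega_j\in\mathbb{R}_+$ for $j\in\Sigma_N$, and $\lambda\ge 0$. Consider the system of equations of motion for vectors $\vec S_j(t)\in\mathbb{R}^3$, $j\in\Sigma_N$, $$\dot{\vec S}_j=\omega_j\,\widehat e_3\times\vec S_j+\lambda\,\vec S_j\times(\vec J\times\vec S_j),\qquad \vec J:=\frac1N\sum_{k=1}^N\vec S_k .$$ When the spins are normalized, $|\vec S_j|=1$, and co-planar in the plane perpendicular to $\widehat e_3$, i.e. $\vec S_j(t)=\langle\cos\theta_j(t),\sin\theta_j(t),0\rangle$ for all $j\in\Sigma_N$, this system reduces to the Kuramoto equations $$\dot\theta_j=\omega_j+\frac{\lambda}{N}\sum_{k=1}^N\sin(\theta_k-\theta_j),\qquad j\in\Sigma_N,$$ equivalently, with $z_j=e^{i\theta_j}$ and $r=\frac1N\sum_{k=1}^N z_k$, to $\dot z_j=i z_j(\omega_j+\lambda[r,z_j])$, $j\in\Sigma_N$.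
   Context: $\widehat e_3=\langle 0,0,1\rangle$ is the third standard basis vector of $\mathbb{R}^3$, $\times$ is the cross product, and a dot denotes the time derivative. For $u,v\in\mathbb{C}$, $[u,v]:=\frac{1}{2i}(u\bar v-v\bar u)\in\mathbb{R}$. *)

theory Defs
  imports "HOL-Analysis.Analysis"
begin

definition average :: "nat \<Rightarrow> (nat \<Rightarrow> 'a::real_vector) \<Rightarrow> 'a" where
  "average N x = (1 / real N) *\<^sub>R (\<Sum>k=1..N. x k)"

abbreviation e3 :: "real ^ 3" where
  "e3 \<equiv> axis 3 1"

definition planar_spin :: "real \<Rightarrow> real ^ 3" where
  "planar_spin \<phi> = vector [cos \<phi>, sin \<phi>, 0]"

text \<open>The value is kept in the complex numbers, as it occurs in complex expressions;
  it is always real, see below.\<close>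

definition bracket :: "complex \<Rightarrow> complex \<Rightarrow> complex" where
  "bracket u v = (1 / (2 * \<i>)) * (u * cnj v - v * cnj u)"

lemma bracket_in_Reals: "bracket u v \<in> \<real>"
  by (simp add: bracket_def complex_is_Real_iff)

text \<open>Derivatives are taken within the time domain \<open>T\<close>, so they are one-sided at endpoints
  belonging to \<open>T\<close>. All three solution predicates include differentiability on \<open>T\<close>.\<close>

definition spin_solution ::
  "nat \<Rightarrow> (nat \<Rightarrow> real) \<Rightarrow> real \<Rightarrow> real set \<Rightarrow> (nat \<Rightarrow> real \<Rightarrow> real ^ 3) \<Rightarrow> bool" where
  "spin_solution N \<omega> lam T S \<longleftrightarrow>
    (\<forall>j\<in>{1..N}. \<forall>t\<in>T.
      (S j has_vector_derivative
        \<omega> j *\<^sub>R cross3 e3 (S j t)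
          + lam *\<^sub>R cross3 (S j t) (cross3 (average N (\<lambda>k. S k t)) (S j t)))
      (at t within T))"

definition kuramoto_solution ::
  "nat \<Rightarrow> (nat \<Rightarrow> real) \<Rightarrow> real \<Rightarrow> real set \<Rightarrow> (nat \<Rightarrow> real \<Rightarrow> real) \<Rightarrow> bool" where
  "kuramoto_solution N \<omega> lam T \<theta> \<longleftrightarrow>
    (\<forall>j\<in>{1..N}. \<forall>t\<in>T.
      (\<theta> j has_real_derivative
        \<omega> j + lam / real N * (\<Sum>k=1..N. sin (\<theta> k t - \<theta> j t)))
      (at t within T))"

definition complex_kuramoto_solution ::
  "nat \<Rightarrow> (nat \<Rightarrow> real) \<Rightarrow> real \<Rightarrow> real set \<Rightarrow> (nat \<Rightarrow> real \<Rightarrow> complex) \<Rightarrow> bool" where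
  "complex_kuramoto_solution N \<omega> lam T z \<longleftrightarrow>
    (\<forall>j\<in>{1..N}. \<forall>t\<in>T.
      (z j has_vector_derivative
        \<i> * z j t * (of_real (\<omega> j) + of_real lam * bracket (average N (\<lambda>k. z k t)) (z j t)))
      (at t within T))"

end

theory Submission
  imports Defs
begin

text \<open>Both systems say that the unit vector \<open>(cos \<theta>\<^sub>j, sin \<theta>\<^sub>j)\<close> moves along the tangent
  \<open>(- sin \<theta>\<^sub>j, cos \<theta>\<^sub>j)\<close> with the Kuramoto speed: for a unit vector \<open>S\<close>, the triple product
  \<open>S \<times> (J \<times> S)\<close> is the projection of \<open>J\<close> orthogonal to \<open>S\<close>, and \<open>bracket r z\<close> is the
  imaginary part of \<open>r * cnj z\<close>. The speed is recovered from the moving vector because a continuous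
  angle equals, near \<open>t\<close>, \<open>\<theta> t + arcsin (sin (\<theta> s - \<theta> t))\<close>. Continuous angles exist since a
  nonvanishing function on an interval has a continuous logarithm.\<close>

lemma has_vector_derivative_vec_iff:
  fixes f :: "real \<Rightarrow> real ^ 'n"
  shows "(f has_vector_derivative D) (at t within T) \<longleftrightarrow>
    (\<forall>i. ((\<lambda>x. f x $ i) has_real_derivative D $ i) (at t within T))"
  unfolding has_vector_derivative_def has_field_derivative_def
  by (subst has_derivative_componentwise_within)
    (simp add: Basis_vec_def inner_axis mult.commute[of _ "D $ _"])

text \<open>\<open>cos\<close> and \<open>sin\<close> determine an angle only modulo 2 pi.
  Continuity excludes jumps, so close to \<open>t\<close> the angle is a smooth function of the two
  and inherits their differentiability.\<close>

lemma has_real_derivative_angle_iff: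
  fixes \<theta> :: "real \<Rightarrow> real"
  assumes "continuous_on T \<theta>" "t \<in> T"
  shows "(\<theta> has_real_derivative a) (at t within T) \<longleftrightarrow>
    ((\<lambda>s. cos (\<theta> s)) has_real_derivative - a * sin (\<theta> t)) (at t within T) \<and>
    ((\<lambda>s. sin (\<theta> s)) has_real_derivative a * cos (\<theta> t)) (at t within T)"
    (is "_ \<longleftrightarrow> ?C \<and> ?S")
proof (intro iffI conjI)
  assume "(\<theta> has_real_derivative a) (at t within T)"
  then show ?C ?S
    by (auto intro!: derivative_eq_intros)
next
  assume CS: "?C \<and> ?S"
  \<comment> \<open>With \<open>t\<close> frozen, this is the component of the moving unit vector
    along the tangent at \<open>t\<close>; the subtraction formula turns it into
    \<open>sin (\<theta> s - \<theta> t)\<close>.\<close>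
  have "((\<lambda>s. sin (\<theta> s) * cos (\<theta> t) - cos (\<theta> s) * sin (\<theta> t)) has_real_derivative
      (a * cos (\<theta> t)) * cos (\<theta> t) - (- a * sin (\<theta> t)) * sin (\<theta> t)) (at t within T)"
    using CS by (intro DERIV_diff DERIV_cmult_right) auto
  moreover have "(a * cos (\<theta> t)) * cos (\<theta> t) - (- a * sin (\<theta> t)) * sin (\<theta> t) = a"
    using sin_cos_squared_add3[of "\<theta> t"] by (simp add: mult.assoc flip: distrib_left)
  ultimately have sin_diff_deriv:
    "((\<lambda>s. sin (\<theta> s - \<theta> t)) has_real_derivative a) (at t within T)"
    by (simp add: sin_diff)
  have "(arcsin has_real_derivative 1) (at (sin (\<theta> t - \<theta> t)))"
    using DERIV_arcsin[of 0] by simp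
  from DERIV_add[OF DERIV_const[of "\<theta> t"] DERIV_chain2[OF this sin_diff_deriv]]
  have arcsin_deriv:
    "((\<lambda>s. \<theta> t + arcsin (sin (\<theta> s - \<theta> t))) has_real_derivative a) (at t within T)"
    by simp
  \<comment> \<open>The bound pi / 2 keeps the angle difference where \<open>arcsin\<close> inverts
    \<open>sin\<close>.\<close>
  obtain d where "d > 0" and d: "\<And>s. s \<in> T \<Longrightarrow> dist s t < d \<Longrightarrow> dist (\<theta> s) (\<theta> t) < pi / 2"
    using assms pi_half_gt_zero unfolding continuous_on_iff by metis
  have "\<theta> t + arcsin (sin (\<theta> s - \<theta> t)) = \<theta> s" if "s \<in> T" "dist s t < d" for s
  proof -
    have "\<bar>\<theta> s - \<theta> t\<bar> < pi / 2"
      using d[OF that] by (simp add: dist_real_def)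
    then have "arcsin (sin (\<theta> s - \<theta> t)) = \<theta> s - \<theta> t"
      by (intro arcsin_sin) linarith+
    then show ?thesis
      by simp
  qed
  with arcsin_deriv \<open>d > 0\<close> \<open>t \<in> T\<close> show "(\<theta> has_real_derivative a) (at t within T)"
    by (rule has_field_derivative_transform_within)
qed

lemma planar_spin_nth [simp]:
  "planar_spin \<phi> $ 1 = cos \<phi>" "planar_spin \<phi> $ 2 = sin \<phi>" "planar_spin \<phi> $ 3 = 0"
  by (simp_all add: planar_spin_def)

lemma norm_planar_spin: "norm (planar_spin \<phi>) = 1"
  by (simp add: norm_eq_1 inner_vec_def sum_3 flip: power2_eq_square)

lemma continuous_on_planar_spin:
  fixes \<theta> :: "real \<Rightarrow> real"
  assumes "continuous_on T \<theta>"
  shows "continuous_on T (\<lambda>t. planar_spin (\<theta> t))"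
proof -
  have "continuous_on T (\<lambda>t. planar_spin (\<theta> t) $ i)" for i :: 3
    using exhaust_3[of i] assms by (auto intro: continuous_on_cos continuous_on_sin)
  then have "continuous_on T (\<lambda>t. \<chi> i. planar_spin (\<theta> t) $ i)"
    by (intro continuous_on_vec_lambda)
  then show ?thesis
    by simp
qed

text \<open>Reading the first two coordinates as a complex number gives a nonvanishing continuous
  function on the contractible set \<open>T\<close>, hence a continuous logarithm. Its imaginary
  part serves as the angle.\<close>

lemma planar_spin_lift:
  fixes S :: "real \<Rightarrow> real ^ 3"
  assumes "is_interval T" "continuous_on T S"
    and unit: "\<And>t. t \<in> T \<Longrightarrow> norm (S t) = 1" and planar: "\<And>t. t \<in> T \<Longrightarrow> S t \<bullet> e3 = 0"
  obtains \<theta> where "continuous_on T \<theta>" "\<And>t. t \<in> T \<Longrightarrow> S t = planar_spin (\<theta> t)"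
proof -
  define f where "f t = Complex (S t $ 1) (S t $ 2)" for t
  have third: "S t $ 3 = 0" if "t \<in> T" for t
    using planar[OF that] by (simp add: inner_axis)
  have norm_f: "norm (f t) = 1" if "t \<in> T" for t
  proof -
    have "S t $ 1 * S t $ 1 + S t $ 2 * S t $ 2 = 1"
      using unit[OF that] third[OF that] by (simp add: norm_eq_1 inner_vec_def sum_3)
    then show ?thesis
      by (simp add: f_def complex_norm power2_eq_square)
  qed
  have "continuous_on T f"
    unfolding f_def using assms(2) by (intro continuous_on_Complex continuous_on_component)
  moreover have "contractible T"
    using assms(1) by (intro convex_imp_contractible is_interval_convex)
  moreover have "f t \<noteq> 0" if "t \<in> T" for t
    using norm_f[OF that] by auto
  ultimately obtain g where g: "continuous_on T g" "\<And>t. t \<in> T \<Longrightarrow> f t = exp (g t)"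
    by (rule continuous_logarithm_on_contractible) auto
  show thesis
  proof
    show "continuous_on T (\<lambda>t. Im (g t))"
      using g(1) by (intro continuous_intros)
    show "S t = planar_spin (Im (g t))" if "t \<in> T" for t
    proof -
      \<comment> \<open>The modulus of \<open>exp (g t)\<close> is \<open>exp (Re (g t))\<close>,
        and here it equals 1.\<close>
      have "Re (g t) = 0"
        using norm_f[OF that] g(2)[OF that] by simp
      then have "Re (f t) = cos (Im (g t))" "Im (f t) = sin (Im (g t))"
        using g(2)[OF that] by (simp_all add: Re_exp Im_exp)
      then show ?thesis
        using third[OF that] by (simp add: vec_eq_iff forall_3 f_def)
    qed
  qed
qed

text \<open>The vector multiplying \<open>a\<close> is the unit tangent of the circle at angle
  \<open>\<theta> t\<close>, so \<open>a\<close> is the angular speed.\<close>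

lemma has_vector_derivative_planar_spin_iff:
  assumes "continuous_on T \<theta>" "t \<in> T"
  shows "((\<lambda>s. planar_spin (\<theta> s)) has_vector_derivative
      a *\<^sub>R vector [- sin (\<theta> t), cos (\<theta> t), 0]) (at t within T) \<longleftrightarrow>
    (\<theta> has_real_derivative a) (at t within T)"
  unfolding has_vector_derivative_vec_iff has_real_derivative_angle_iff[OF assms]
  by (simp add: forall_3)

lemma has_vector_derivative_cis_iff:
  assumes "continuous_on T \<theta>" "t \<in> T"
  shows "((\<lambda>s. cis (\<theta> s)) has_vector_derivative \<i> * cis (\<theta> t) * of_real a) (at t within T) \<longleftrightarrow>
    (\<theta> has_real_derivative a) (at t within T)"
  unfolding has_vector_derivative_complex_iff has_real_derivative_angle_iff[OF assms]
  by (simp add: mult.commute)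

text \<open>The phases \<open>\<phi>\<close> are those at one frozen instant. This scalar is the
  common angular speed to which the spin and the complex equations are both reduced.\<close>

definition kuramoto_speed ::
  "nat \<Rightarrow> (nat \<Rightarrow> real) \<Rightarrow> real \<Rightarrow> (nat \<Rightarrow> real) \<Rightarrow> nat \<Rightarrow> real" where
  "kuramoto_speed N \<omega> lam \<phi> j = \<omega> j + lam / real N * (\<Sum>k=1..N. sin (\<phi> k - \<phi> j))"

text \<open>Separates the angle \<open>a\<close> from the sums, which up to the factor 1 / N are the
  components of the mean spin.\<close>

lemma sum_sin_diff:
  fixes \<phi> :: "'a \<Rightarrow> real"
  shows "(\<Sum>k\<in>A. sin (\<phi> k - a)) = (\<Sum>k\<in>A. sin (\<phi> k)) * cos a - (\<Sum>k\<in>A. cos (\<phi> k)) * sin a"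
  by (simp add: sin_diff sum_subtractf sum_distrib_right)

text \<open>For horizontal \<open>J\<close> the inner product is vertical in direction:
  \<open>cross3 J (planar_spin \<phi>)\<close> is a multiple of \<open>e3\<close>, and crossing the
  spin with it gives a tangent vector. The coefficient is the tangential component of
  \<open>J\<close>.\<close>

lemma cross3_cross3_planar_spin:
  assumes "J $ 3 = 0"
  shows "cross3 (planar_spin \<phi>) (cross3 J (planar_spin \<phi>)) =
    (J $ 2 * cos \<phi> - J $ 1 * sin \<phi>) *\<^sub>R vector [- sin \<phi>, cos \<phi>, 0]"
  using assms by (simp add: cross3_def vec_eq_iff forall_3 algebra_simps)

text \<open>Rotation about \<open>e3\<close> contributes \<open>\<omega> j\<close> to the speed
  along the tangent; the coupling contributes \<open>lam\<close> times the tangential component of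
  the mean spin, which is the mean of the sines.\<close>

lemma spin_velocity:
  "\<omega> j *\<^sub>R cross3 e3 (planar_spin (\<phi> j)) + lam *\<^sub>R cross3 (planar_spin (\<phi> j))
      (cross3 (average N (\<lambda>k. planar_spin (\<phi> k))) (planar_spin (\<phi> j))) =
    kuramoto_speed N \<omega> lam \<phi> j *\<^sub>R vector [- sin (\<phi> j), cos (\<phi> j), 0]"
proof -
  let ?J = "average N (\<lambda>k. planar_spin (\<phi> k))" and ?v = "vector [- sin (\<phi> j), cos (\<phi> j), 0] :: real ^ 3"
  have J: "?J $ 1 = (\<Sum>k=1..N. cos (\<phi> k)) / N" "?J $ 2 = (\<Sum>k=1..N. sin (\<phi> k)) / N" "?J $ 3 = 0"
    by (simp_all add: average_def)
  have "cross3 e3 (planar_spin (\<phi> j)) = ?v"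
    by (simp add: cross3_def vec_eq_iff forall_3 axis_def)
  moreover have "lam * (?J $ 2 * cos (\<phi> j) - ?J $ 1 * sin (\<phi> j)) =
      lam / N * (\<Sum>k=1..N. sin (\<phi> k - \<phi> j))"
    unfolding J sum_sin_diff by (simp add: diff_divide_distrib algebra_simps)
  ultimately show ?thesis
    by (simp add: cross3_cross3_planar_spin[OF J(3)] kuramoto_speed_def scaleR_left_distrib)
qed

text \<open>With \<open>w = u * cnj v\<close>, the bracket is \<open>w - cnj w\<close> divided by
  \<open>2 * \<i>\<close>.\<close>

lemma bracket_eq_Im: "bracket u v = of_real (Im (u * cnj v))"
  using complex_diff_cnj[of "u * cnj v"] by (simp add: bracket_def mult.commute)

text \<open>Each product \<open>cis (\<phi> k) * cnj (cis (\<phi> j))\<close> has imaginary part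
  \<open>sin (\<phi> k - \<phi> j)\<close>, and \<open>Im\<close> commutes with averaging.\<close>

lemma kuramoto_speed_complex:
  "of_real (\<omega> j) + of_real lam * bracket (average N (\<lambda>k. cis (\<phi> k))) (cis (\<phi> j)) =
    of_real (kuramoto_speed N \<omega> lam \<phi> j)"
proof -
  have "Im (average N (\<lambda>k. cis (\<phi> k)) * cnj (cis (\<phi> j))) = (\<Sum>k=1..N. sin (\<phi> k - \<phi> j)) / N"
    unfolding sum_sin_diff by (simp add: average_def diff_divide_distrib)
  then show ?thesis
    by (simp add: bracket_eq_Im kuramoto_speed_def)
qed

theorem theorem5:
  fixes N :: nat and \<omega> :: "nat \<Rightarrow> real" and lam :: real and T :: "real set"
  assumes "N \<ge> 1"
    and "\<forall>j\<in>{1..N}. \<omega> j \<ge> 0"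
    and "lam \<ge> 0"
    and "is_interval T" and "interior T \<noteq> {}"
  shows
    "(\<forall>S :: nat \<Rightarrow> real \<Rightarrow> real ^ 3.
        (\<forall>j\<in>{1..N}. continuous_on T (S j) \<and> (\<forall>t\<in>T. norm (S j t) = 1 \<and> S j t \<bullet> e3 = 0)) \<longleftrightarrow>
        (\<exists>\<theta> :: nat \<Rightarrow> real \<Rightarrow> real.
          \<forall>j\<in>{1..N}. continuous_on T (\<theta> j) \<and> (\<forall>t\<in>T. S j t = planar_spin (\<theta> j t))))
     \<and>
     (\<forall>(S :: nat \<Rightarrow> real \<Rightarrow> real ^ 3) (\<theta> :: nat \<Rightarrow> real \<Rightarrow> real).
        (\<forall>j\<in>{1..N}. continuous_on T (\<theta> j) \<and> (\<forall>t\<in>T. S j t = planar_spin (\<theta> j t))) \<longrightarrow>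
        (spin_solution N \<omega> lam T S \<longleftrightarrow> kuramoto_solution N \<omega> lam T \<theta>) \<and>
        (kuramoto_solution N \<omega> lam T \<theta> \<longleftrightarrow>
          complex_kuramoto_solution N \<omega> lam T (\<lambda>j t. exp (\<i> * of_real (\<theta> j t)))))"
proof (rule conjI; intro allI)
  fix S :: "nat \<Rightarrow> real \<Rightarrow> real ^ 3"
  show "(\<forall>j\<in>{1..N}. continuous_on T (S j) \<and> (\<forall>t\<in>T. norm (S j t) = 1 \<and> S j t \<bullet> e3 = 0)) \<longleftrightarrow>
    (\<exists>\<theta>. \<forall>j\<in>{1..N}. continuous_on T (\<theta> j) \<and> (\<forall>t\<in>T. S j t = planar_spin (\<theta> j t)))"
    (is "?L \<longleftrightarrow> ?R")
  proof
    assume ?L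
    \<comment> \<open>Each spin is lifted separately; choice then assembles the angles into one
      family.\<close>
    then have "\<forall>j\<in>{1..N}. \<exists>f. continuous_on T f \<and> (\<forall>t\<in>T. S j t = planar_spin (f t))"
      by (metis planar_spin_lift[OF \<open>is_interval T\<close>])
    then show ?R
      by (rule bchoice)
  next
    assume ?R
    then obtain \<theta> where
      "\<forall>j\<in>{1..N}. continuous_on T (\<theta> j) \<and> (\<forall>t\<in>T. S j t = planar_spin (\<theta> j t))"
      by blast
    then have \<theta>: "continuous_on T (\<theta> j)" "\<And>t. t \<in> T \<Longrightarrow> S j t = planar_spin (\<theta> j t)"
      if "j \<in> {1..N}" for j
      using that by blast+
    show ?L
    proof (intro ballI conjI)
      fix j assume j: "j \<in> {1..N}"
      show "continuous_on T (S j)"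
        using continuous_on_planar_spin[OF \<theta>(1)[OF j]] \<theta>(2)[OF j]
        by (simp cong: continuous_on_cong)
      fix t assume "t \<in> T"
      then show "norm (S j t) = 1" "S j t \<bullet> e3 = 0"
        using \<theta>(2)[OF j] by (simp_all add: norm_planar_spin inner_axis)
    qed
  qed
next
  fix S :: "nat \<Rightarrow> real \<Rightarrow> real ^ 3" and \<theta> :: "nat \<Rightarrow> real \<Rightarrow> real"
  show "(\<forall>j\<in>{1..N}. continuous_on T (\<theta> j) \<and> (\<forall>t\<in>T. S j t = planar_spin (\<theta> j t))) \<longrightarrow>
    (spin_solution N \<omega> lam T S \<longleftrightarrow> kuramoto_solution N \<omega> lam T \<theta>) \<and>
    (kuramoto_solution N \<omega> lam T \<theta> \<longleftrightarrow>
      complex_kuramoto_solution N \<omega> lam T (\<lambda>j t. exp (\<i> * of_real (\<theta> j t))))"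
  proof
    assume "\<forall>j\<in>{1..N}. continuous_on T (\<theta> j) \<and> (\<forall>t\<in>T. S j t = planar_spin (\<theta> j t))"
    then have cont: "continuous_on T (\<theta> j)" and S: "\<And>t. t \<in> T \<Longrightarrow> S j t = planar_spin (\<theta> j t)"
      if "j \<in> {1..N}" for j
      using that by blast+
    have spin: "(S j has_vector_derivative
        \<omega> j *\<^sub>R cross3 e3 (S j t)
          + lam *\<^sub>R cross3 (S j t) (cross3 (average N (\<lambda>k. S k t)) (S j t))) (at t within T) \<longleftrightarrow>
      (\<theta> j has_real_derivative kuramoto_speed N \<omega> lam (\<lambda>k. \<theta> k t) j) (at t within T)"
      if j: "j \<in> {1..N}" and t: "t \<in> T" for j t
    proof -
      have "average N (\<lambda>k. S k t) = average N (\<lambda>k. planar_spin (\<theta> k t))"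
        unfolding average_def using S t by simp
      \<comment> \<open>\<open>S j\<close> and the planar spin agree on \<open>T\<close>, and a
        derivative within \<open>T\<close> at a point of \<open>T\<close> sees only values
        there.\<close>
      moreover have "(S j has_vector_derivative D) (at t within T) \<longleftrightarrow>
          ((\<lambda>s. planar_spin (\<theta> j s)) has_vector_derivative D) (at t within T)" for D
        using S[OF j] t
        by (metis (no_types, lifting) has_vector_derivative_transform)
      ultimately show ?thesis
        by (simp only: S[OF j t] spin_velocity[of \<omega> j "\<lambda>k. \<theta> k t" lam N]
            has_vector_derivative_planar_spin_iff[OF cont[OF j] t])
    qed
    \<comment> \<open>Both this equivalence and \<open>spin\<close> have the same scalar condition
      on their right-hand side, which links the three systems.\<close>
    have complex: "((\<lambda>t. cis (\<theta> j t)) has_vector_derivative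
        \<i> * cis (\<theta> j t) * (of_real (\<omega> j) + of_real lam *
          bracket (average N (\<lambda>k. cis (\<theta> k t))) (cis (\<theta> j t)))) (at t within T) \<longleftrightarrow>
      (\<theta> j has_real_derivative kuramoto_speed N \<omega> lam (\<lambda>k. \<theta> k t) j) (at t within T)"
      if j: "j \<in> {1..N}" and t: "t \<in> T" for j t
      by (simp only: kuramoto_speed_complex[of \<omega> j lam N "\<lambda>k. \<theta> k t"]
          has_vector_derivative_cis_iff[OF cont[OF j] t])
    have "spin_solution N \<omega> lam T S \<longleftrightarrow> kuramoto_solution N \<omega> lam T \<theta>"
      unfolding spin_solution_def kuramoto_solution_def
      using spin by (simp add: kuramoto_speed_def)
    moreover have "kuramoto_solution N \<omega> lam T \<theta> \<longleftrightarrow>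
        complex_kuramoto_solution N \<omega> lam T (\<lambda>j t. exp (\<i> * of_real (\<theta> j t)))"
      unfolding complex_kuramoto_solution_def kuramoto_solution_def cis_conv_exp[symmetric]
      using complex by (simp add: kuramoto_speed_def)
    ultimately show "(spin_solution N \<omega> lam T S \<longleftrightarrow> kuramoto_solution N \<omega> lam T \<theta>) \<and>
        (kuramoto_solution N \<omega> lam T \<theta> \<longleftrightarrow>
          complex_kuramoto_solution N \<omega> lam T (\<lambda>j t. exp (\<i> * of_real (\<theta> j t))))"
      by blast
  qed
qed

end
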